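(* Let $\mathcal D$ be any probability distribution on $\mathcal X\times\mathcal Y$, let $Q$ be any probability distribution over the predictor space $\mathcal H$, and let $\mathbf h\in\mathcal H$ be such that $b_{\mathcal D}^Q(\mathbf h)$ and $c_{\mathcal D}^Q(\mathbf h)$ are well defined and $c_{\mathcal D}^Q(\mathbf h)\neq b_{\mathcal D}^Q(\mathbf h)$. Then $$\mathcal L_{\mathcal D}(\mathbf h)=\frac{\mathbb E_{\mathbf h'\sim Q}\,\mathcal L_{\mathcal D}(\mathbf h')-b_{\mathcal D}^Q(\mathbf h)}{c_{\mathcal D}^Q(\mathbf h)-b_{\mathcal D}^Q(\mathbf h)}.$$
   Context: $\mathcal X$ is a feature space, $\mathcal Y$ a finite label set, $\mathcal H$ a set of predictors $\mathbf h:\mathcal X\to\mathcal Y'$, and $\ell:\mathcal Y'\times\mathcal Y\to\{0,1\}$ a binary loss (all objects are assumed measurable as needed). The deterministic risk is $\mathcal L_{\mathcal D}(\mathbf h)=\mathbb E_{(\mathbf x,\mathbf y)\sim\mathcal D}[\ell(\mathbf h(\mathbf x),\mathbf y)]$. Define $$b_{\mathcal D}^Q(\mathbf h)=\mathbb E_{(\mathbf x,\mathbf y)\sim\mathcal D}\Big[\mathbb E_{\mathbf h'\sim Q}\,\ell(\mathbf h'(\mathbf x),\mathbf y)\,\Big|\,\ell(\mathbf h(\mathbf x),\mathbf y)=0\Big],\qquad c_{\mathcal D}^Q(\mathbf h)=\mathbb E_{(\mathbf x,\mathbf y)\sim\mathcal D}\Big[\mathbb E_{\mathbf h'\sim Q}\,\ell(\mathbf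 h'(\mathbf x),\mathbf y)\,\Big|\,\ell(\mathbf h(\mathbf x),\mathbf y)=1\Big].$$ These are conditional expectations given events, well defined when the conditioning events have positive $\mathcal D$-probability. *)

theory Defs
  imports "HOL-Probability.Probability"
begin

text \<open>The law of \<open>M\<close> conditioned on an event \<open>A\<close> of positive probability is
  \<^term>\<open>uniform_measure M A\<close>, which maps \<open>B\<close> to \<open>M (A \<inter> B) / M A\<close>; it is not required that
  \<open>M\<close> itself be uniform.\<close>

definition event_expectation :: "'a measure \<Rightarrow> ('a \<Rightarrow> real) \<Rightarrow> 'a set \<Rightarrow> real" where
  "event_expectation M f A = (\<integral>x. f x \<partial>(uniform_measure M A))"

definition risk :: "('z \<Rightarrow> 'y \<Rightarrow> real) \<Rightarrow> ('x \<times> 'y) measure \<Rightarrow> ('x \<Rightarrow> 'z) \<Rightarrow> real" where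
  "risk l D h = (\<integral>(x, y). l (h x) y \<partial>D)"

definition gibbs_loss ::
    "('z \<Rightarrow> 'y \<Rightarrow> real) \<Rightarrow> ('x \<Rightarrow> 'z) measure \<Rightarrow> 'x \<times> 'y \<Rightarrow> real" where
  "gibbs_loss l Q = (\<lambda>(x, y). \<integral>h'. l (h' x) y \<partial>Q)"

definition loss_event ::
    "('z \<Rightarrow> 'y \<Rightarrow> real) \<Rightarrow> ('x \<times> 'y) measure \<Rightarrow> ('x \<Rightarrow> 'z) \<Rightarrow> real \<Rightarrow> ('x \<times> 'y) set" where
  "loss_event l D h v = {(x, y) \<in> space D. l (h x) y = v}"

definition b_coef ::
    "('z \<Rightarrow> 'y \<Rightarrow> real) \<Rightarrow> ('x \<times> 'y) measure \<Rightarrow> ('x \<Rightarrow> 'z) measure \<Rightarrow> ('x \<Rightarrow> 'z) \<Rightarrow> real" where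
  "b_coef l D Q h = event_expectation D (gibbs_loss l Q) (loss_event l D h 0)"

definition c_coef ::
    "('z \<Rightarrow> 'y \<Rightarrow> real) \<Rightarrow> ('x \<times> 'y) measure \<Rightarrow> ('x \<Rightarrow> 'z) measure \<Rightarrow> ('x \<Rightarrow> 'z) \<Rightarrow> real" where
  "c_coef l D Q h = event_expectation D (gibbs_loss l Q) (loss_event l D h 1)"

end

theory Submission
  imports Defs
begin

text \<open>The law of total expectation over the partition of the sample space by the value of the loss
  of \<open>h\<close> reads \<open>E G = b (1 - L) + c L\<close>, where \<open>G\<close> is the Gibbs loss and \<open>L\<close> the risk of \<open>h\<close>;
  by Fubini, \<open>E G\<close> is the expected risk. Solve for \<open>L\<close>.\<close>

text \<open>\<open>uniform_measure M A\<close> is the density of \<open>M\<close> with weight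
  \<open>indicator A x / emeasure M A\<close>. Once this weight is known to be a real number, the
  integral against the density turns into a weighted integral over \<open>M\<close>.\<close>

lemma event_expectation_eq:
  assumes f: "f \<in> borel_measurable M" and A: "A \<in> sets M" and pos: "measure M A > 0"
  shows "event_expectation M f A = (\<integral>x. indicator A x * f x \<partial>M) / measure M A"
proof -
  \<comment> \<open>\<open>measure\<close> takes the value 0 on sets of infinite measure, so
    positivity also yields finiteness.\<close>
  have fin: "emeasure M A = ennreal (measure M A)"
    using pos by (intro emeasure_eq_ennreal_measure) (auto simp: measure_def)
  have dens: "indicator A x / emeasure M A = ennreal (indicator A x / measure M A)" for x
    using pos by (auto simp: fin indicator_def divide_ennreal simp flip: ennreal_1)
  have "event_expectation M f A = (\<integral>x. (indicator A x / measure M A) *\<^sub>R f x \<partial>M)"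
    unfolding event_expectation_def uniform_measure_def dens
    using f A by (intro integral_density) auto
  then show ?thesis by simp
qed

text \<open>Since \<open>g\<close> agrees with the indicator of its level set at 1, its expectation
  is the probability of that set, and \<open>1 - expectation g\<close> is that of the level set at
  0. These are the weights in the law of total expectation.\<close>

lemma (in prob_space) expectation_binary_partition:
  fixes f g :: "'a \<Rightarrow> real"
  assumes f: "integrable M f" and g: "g \<in> borel_measurable M"
    and bin: "\<And>x. x \<in> space M \<Longrightarrow> g x \<in> {0, 1}"
    and pos: "prob {x \<in> space M. g x = 0} > 0" "prob {x \<in> space M. g x = 1} > 0"
  shows "expectation f =
    event_expectation M f {x \<in> space M. g x = 0} * (1 - expectation g) +
    event_expectation M f {x \<in> space M. g x = 1} * expectation g"
proof -
  define A where "A v = {x \<in> space M. g x = v}" for v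
  have A[measurable]: "A v \<in> events" for v
    unfolding A_def using g by measurable
  have "expectation g = expectation (indicator (A 1))"
    using bin by (intro Bochner_Integration.integral_cong) (auto simp: A_def indicator_def)
  then have g1: "expectation g = prob (A 1)"
    using A by simp
  have "A 0 = space M - A 1"
    using bin by (auto simp: A_def)
  then have g0: "1 - expectation g = prob (A 0)"
    using A by (simp add: g1 prob_compl)
  have int: "integrable M (\<lambda>x. indicator (A v) x * f x)" for v
    using integrable_mult_indicator[OF A f] by simp
  have "expectation f = expectation (\<lambda>x. indicator (A 0) x * f x + indicator (A 1) x * f x)"
    using bin by (intro Bochner_Integration.integral_cong) (auto simp: A_def indicator_def)
  \<comment> \<open>Each probability cancels the normalising denominator in
    \<open>event_expectation_eq\<close>; both are nonzero by \<open>pos\<close>.\<close>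
  also have "\<dots> = event_expectation M f (A 0) * prob (A 0) + event_expectation M f (A 1) * prob (A 1)"
    using f A pos int by (simp add: event_expectation_eq A_def[symmetric] borel_measurable_integrable)
  finally show ?thesis
    unfolding g0 unfolding g1 by (simp only: A_def)
qed

theorem proposition1:
  fixes X :: "'x measure" and Y :: "'y set" and Y' :: "'z set"
    and H :: "('x \<Rightarrow> 'z) measure"
    and l :: "'z \<Rightarrow> 'y \<Rightarrow> real"
    and D :: "('x \<times> 'y) measure" and Q :: "('x \<Rightarrow> 'z) measure"
    and h :: "'x \<Rightarrow> 'z"
  assumes "finite Y"
    and "\<And>z y. z \<in> Y' \<Longrightarrow> y \<in> Y \<Longrightarrow> l z y \<in> {0, 1}"
    and "space H \<subseteq> space X \<rightarrow> Y'"
    and "(\<lambda>(h', x, y). l (h' x) y) \<in> borel_measurable (H \<Otimes>\<^sub>M (X \<Otimes>\<^sub>M count_space Y))"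
    and "prob_space D" and "sets D = sets (X \<Otimes>\<^sub>M count_space Y)"
    and "prob_space Q" and "sets Q = sets H"
    and "h \<in> space H"
    and "measure D (loss_event l D h 0) > 0"
    and "measure D (loss_event l D h 1) > 0"
    and "c_coef l D Q h \<noteq> b_coef l D Q h"
  shows "risk l D h =
    ((\<integral>h'. risk l D h' \<partial>Q) - b_coef l D Q h) / (c_coef l D Q h - b_coef l D Q h)"
proof -
  interpret D: prob_space D by fact
  interpret Q: prob_space Q by fact
  interpret QD: pair_prob_space Q D ..
  \<comment> \<open>One function on the product carries everything: integrating out the pair gives
    the risk, integrating out the predictor gives the Gibbs loss, and the section at
    \<open>h\<close> is the loss of \<open>h\<close>.\<close>
  define L :: "('x \<Rightarrow> 'z) \<times> 'x \<times> 'y \<Rightarrow> real" where "L = (\<lambda>(h', x, y). l (h' x) y)"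
  have spQ: "space Q = space H" and spD: "space D = space X \<times> Y"
    using sets_eq_imp_space_eq[OF assms(8)] sets_eq_imp_space_eq[OF assms(6)]
    by (auto simp: space_pair_measure)
  have L: "L \<in> borel_measurable (Q \<Otimes>\<^sub>M D)"
    unfolding L_def measurable_cong_sets[OF sets_pair_measure_cong[OF assms(8,6)] refl]
    by (rule assms(4))
  have bin: "L (h', p) \<in> {0, 1}" if "h' \<in> space H" "p \<in> space D" for h' p
  proof -
    obtain x y where p: "p = (x, y)" "x \<in> space X" "y \<in> Y"
      using \<open>p \<in> space D\<close> by (auto simp: spD)
    with assms(3) \<open>h' \<in> space H\<close> have "h' x \<in> Y'"
      by blast
    with assms(2) p show ?thesis
      by (simp add: L_def)
  qed
  \<comment> \<open>A measurable function bounded by 1 is integrable on a probability space. This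
    justifies Fubini and the integrability of the Gibbs loss.\<close>
  have int: "integrable (Q \<Otimes>\<^sub>M D) L"
  proof (rule QD.integrable_const_bound[where B = 1])
    show "AE z in Q \<Otimes>\<^sub>M D. norm (L z) \<le> 1"
    proof (rule AE_I2)
      fix z assume "z \<in> space (Q \<Otimes>\<^sub>M D)"
      with bin[of "fst z" "snd z"] show "norm (L z) \<le> 1"
        by (auto simp: space_pair_measure spQ)
    qed
  qed (rule L)
  have risk: "risk l D h' = (\<integral>p. L (h', p) \<partial>D)" for h'
    by (simp add: risk_def L_def)
  have gibbs: "gibbs_loss l Q = (\<lambda>p. \<integral>h'. L (h', p) \<partial>Q)"
    by (auto simp: gibbs_loss_def L_def)
  have event: "loss_event l D h v = {p \<in> space D. L (h, p) = v}" for v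
    by (auto simp: loss_event_def L_def)
  have "(\<integral>h'. risk l D h' \<partial>Q) = (\<integral>p. gibbs_loss l Q p \<partial>D)"
    unfolding risk gibbs using QD.Fubini_integral[of "\<lambda>h' p. L (h', p)"] int by simp
  \<comment> \<open>Total expectation is applied with the Gibbs loss as \<open>f\<close> and the
    loss of \<open>h\<close> as \<open>g\<close>, whose level sets are the two conditioning
    events.\<close>
  also have "\<dots> = b_coef l D Q h * (1 - risk l D h) + c_coef l D Q h * risk l D h"
    unfolding b_coef_def c_coef_def risk event
  proof (rule D.expectation_binary_partition)
    show "integrable D (gibbs_loss l Q)"
      unfolding gibbs using QD.integrable_snd[of "\<lambda>h' p. L (h', p)"] int by simp
    \<comment> \<open>Sections of a jointly measurable function are measurable, and \<open>h\<close>
      is a point of \<open>space Q\<close>.\<close>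
    show "(\<lambda>p. L (h, p)) \<in> borel_measurable D"
      using L by (rule measurable_Pair2) (simp add: spQ assms(9))
    show "L (h, p) \<in> {0, 1}" if "p \<in> space D" for p
      using bin assms(9) that .
  qed (use assms(10,11) in \<open>simp_all only: event\<close>)
  finally have "(\<integral>h'. risk l D h' \<partial>Q) - b_coef l D Q h =
      risk l D h * (c_coef l D Q h - b_coef l D Q h)"
    by (simp only: algebra_simps)
  with assms(12) show ?thesis
    by simp
qed

end
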